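(* Let $(a,b)\in\Delta_{(0,1)}$, where $a=a_1a_2$, $b=b_1b_2$, $0<a_1<a_2<1$, $b_j=\sqrt{1-a_j^2}$ (so $0<b_2<b_1<1$). For any bounded continuous function $\tilde h(v,u)$ on $\mathbb R^2$, in the limit $b\to0$ (meaning $a_1$ is fixed and $b_2\to0+$), $$\lim_{b\to0}\iint_{\tilde D_1}\tilde h\,\tilde K_\pm\,dv\,du=0,\qquad \lim_{b\to0}\iint_{\tilde D_2}\tilde h\,\tilde K_\pm\,dv\,du=\frac{\pi b_1}{4}\int_{-a_1}^{a_1}\frac{1-v^2}{\sqrt{a_1^2-v^2}}\,\tilde h(v,0)\,dv .$$
   Context: $\Delta_{(0,1)}=\{(a,b):a,b>0,\ a+b<1\}$. For $j=1,2$ put $\tilde F_j(v,u)=1-\frac{v^2}{a_j^2}-\frac{u^2}{b_j^2}$, $\tilde E_j=\{(v,u):\tilde F_j\ge0\}$, and $\tilde F_0(v,u)=\frac{(a_1b_2)^2+(a_2b_1)^2}{2ab}\Bigl[1-\frac{v^2}{a_0^2}-\frac{u^2}{b_0^2}\Bigr]$ with $a_0^2=\frac{(a_1b_2)^2+(a_2b_1)^2}{b_1^2+b_2^2}$, $b_0^2=\frac{(a_1b_2)^2+(a_2b_1)^2}{a_1^2+a_2^2}$. Define $\tilde K_\pm=\frac{\tilde F_0\pm\sqrt{\tilde F_1\tilde F_2}}{2\sqrt{\tilde F_1\tilde F_2}}\,I_{\tilde E_1\cap\tilde E_2}$ ($I_S$ = indicator function). With $r_j=(b_j/a_j)\sqrt{a_j^2-v^2}$,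 set $\tilde D_1=\{(v,u): a<|v|\le a_1,\ |u|\le r_1\}$ and $\tilde D_2=\{(v,u):|v|\le a,\ |u|\le r_2\}$; one has the disjoint decomposition $\tilde E_1\cap\tilde E_2=\tilde D_1\cup\tilde D_2$. *)

theory Defs
  imports "HOL-Analysis.Analysis"
begin

definition Delta01 :: "(real \<times> real) set" where
  "Delta01 = {(a, b). 0 < a \<and> 0 < b \<and> a + b < 1}"

definition admissible :: "real \<Rightarrow> real \<Rightarrow> real \<Rightarrow> real \<Rightarrow> bool" where
  "admissible a1 b1 a2 b2 \<longleftrightarrow>
     0 < a1 \<and> a1 < a2 \<and> a2 < 1 \<and> b1 = sqrt (1 - a1\<^sup>2) \<and> b2 = sqrt (1 - a2\<^sup>2) \<and>
     (a1 * a2, b1 * b2) \<in> Delta01"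

text \<open>Points of the plane are pairs \<open>(v, u)\<close>. The objects indexed by \<open>j = 1, 2\<close> are
  instances of \<open>F_ell\<close>, \<open>E_ell\<close> and \<open>r_ell\<close> at \<open>(a\<^sub>j, b\<^sub>j)\<close>.\<close>

definition F_ell :: "real \<Rightarrow> real \<Rightarrow> real \<times> real \<Rightarrow> real" where
  "F_ell aj bj = (\<lambda>(v, u). 1 - v\<^sup>2 / aj\<^sup>2 - u\<^sup>2 / bj\<^sup>2)"

definition E_ell :: "real \<Rightarrow> real \<Rightarrow> (real \<times> real) set" where
  "E_ell aj bj = {z. F_ell aj bj z \<ge> 0}"

definition r_ell :: "real \<Rightarrow> real \<Rightarrow> real \<Rightarrow> real" where
  "r_ell aj bj v = (bj / aj) * sqrt (aj\<^sup>2 - v\<^sup>2)"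

definition a0_sq :: "real \<Rightarrow> real \<Rightarrow> real \<Rightarrow> real \<Rightarrow> real" where
  "a0_sq a1 b1 a2 b2 = ((a1 * b2)\<^sup>2 + (a2 * b1)\<^sup>2) / (b1\<^sup>2 + b2\<^sup>2)"

definition b0_sq :: "real \<Rightarrow> real \<Rightarrow> real \<Rightarrow> real \<Rightarrow> real" where
  "b0_sq a1 b1 a2 b2 = ((a1 * b2)\<^sup>2 + (a2 * b1)\<^sup>2) / (a1\<^sup>2 + a2\<^sup>2)"

definition F0 :: "real \<Rightarrow> real \<Rightarrow> real \<Rightarrow> real \<Rightarrow> real \<times> real \<Rightarrow> real" where
  "F0 a1 b1 a2 b2 = (\<lambda>(v, u).
     ((a1 * b2)\<^sup>2 + (a2 * b1)\<^sup>2) / (2 * (a1 * a2) * (b1 * b2)) *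
     (1 - v\<^sup>2 / a0_sq a1 b1 a2 b2 - u\<^sup>2 / b0_sq a1 b1 a2 b2))"

text \<open>\<open>K_fun s\<close> is the kernel with upper sign for \<open>s = 1\<close> and with lower sign for \<open>s = - 1\<close>.
  On the boundary of the domain, a null set, the denominator vanishes and the value is \<open>0\<close>.\<close>

definition K_fun :: "real \<Rightarrow> real \<Rightarrow> real \<Rightarrow> real \<Rightarrow> real \<Rightarrow> real \<times> real \<Rightarrow> real" where
  "K_fun s a1 b1 a2 b2 z =
     (F0 a1 b1 a2 b2 z + s * sqrt (F_ell a1 b1 z * F_ell a2 b2 z)) /
     (2 * sqrt (F_ell a1 b1 z * F_ell a2 b2 z)) *
     indicator (E_ell a1 b1 \<inter> E_ell a2 b2) z"

definition D1 :: "real \<Rightarrow> real \<Rightarrow> real \<Rightarrow> real \<Rightarrow> (real \<times> real) set" where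
  "D1 a1 b1 a2 b2 = {(v, u). a1 * a2 < \<bar>v\<bar> \<and> \<bar>v\<bar> \<le> a1 \<and> \<bar>u\<bar> \<le> r_ell a1 b1 v}"

definition D2 :: "real \<Rightarrow> real \<Rightarrow> real \<Rightarrow> real \<Rightarrow> (real \<times> real) set" where
  "D2 a1 b1 a2 b2 = {(v, u). \<bar>v\<bar> \<le> a1 * a2 \<and> \<bar>u\<bar> \<le> r_ell a2 b2 v}"

lemma admissible_small_b2:
  assumes "0 < a1" "a1 < 1" "0 < b2" "b2 < sqrt (1 - a1\<^sup>2)"
  shows "admissible a1 (sqrt (1 - a1\<^sup>2)) (sqrt (1 - b2\<^sup>2)) b2"
proof -
  define a2 where "a2 = sqrt (1 - b2\<^sup>2)"
  define b1 where "b1 = sqrt (1 - a1\<^sup>2)"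
  have a1sq: "a1\<^sup>2 < 1" using assms by (simp add: power_less_one_iff)
  hence b1sq: "b1\<^sup>2 = 1 - a1\<^sup>2" and b1pos: "b1 > 0" by (simp_all add: b1_def)
  have "b2\<^sup>2 < b1\<^sup>2" using assms by (intro power_strict_mono) (auto simp: b1_def)
  hence lt: "a1\<^sup>2 < 1 - b2\<^sup>2" using b1sq by simp
  have b2pos: "b2\<^sup>2 > 0" using assms by simp
  have a2sq: "a2\<^sup>2 = 1 - b2\<^sup>2"
    using lt zero_le_power2[of a1] unfolding a2_def by (intro real_sqrt_pow2) linarith
  have a12: "a1 < a2" unfolding a2_def using lt by (rule real_less_rsqrt)
  have "a2 < 1" unfolding a2_def using b2pos by simp
  moreover have "b2 = sqrt (1 - a2\<^sup>2)" using assms a2sq by simp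
  moreover have "a1 * a2 + b1 * b2 < 1"
  proof -
    have "0 < (a1 - a2)\<^sup>2" using a12 by simp
    moreover have "0 \<le> (b1 - b2)\<^sup>2" by simp
    ultimately have "0 < (a1 - a2)\<^sup>2 + (b1 - b2)\<^sup>2" by linarith
    thus ?thesis using a2sq b1sq by (simp add: power2_diff)
  qed
  ultimately show ?thesis
    using assms a12 b1pos unfolding admissible_def Delta01_def a2_def[symmetric] b1_def[symmetric]
    by auto
qed

end

(*
  Substituting v = a1 a2 t and u = m(t) w, where m(t) is the half-width of the fiber of the
  intersection of the ellipses over v, maps the domains to |w| <= 1 with |t| <= 1 (for D2) and
  1 < |t| <= 1 / a2 (for D1).  The Jacobian a1 a2 m(t) cancels the singularity of the kernel as
  b2 -> 0, and since r2^2 - r1^2 = (a2^2 - a1^2) (t^2 - 1), the product of kernel and Jacobian is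
  at most C / (sqrt |1 - t^2| sqrt (1 - w^2)) with C bounded for small b2.  This majorant is
  integrable, so dominated convergence applies; the integral over w of 1 / sqrt (1 - w^2)
  contributes the factor pi.
*)
theory Submission
  imports Defs
begin

text \<open>As \<open>b2\<close> tends to 0 the region collapses to a segment of the line u = 0
  while the kernel grows like 1 / \<open>b2\<close>. The rescaling balances the two exactly, for
  every \<open>b2\<close> and not only in the limit: \<open>F0\<close> carries the factor 1 / (2 a1
  a2 b1 b2), and b1 b2 sqrt (F1 F2) = m sqrt (1 - w^2) sqrt Q at the rescaled point, where Q is
  \<open>kernel_den\<close>. With the Jacobian only 1 / (sqrt (1 - w^2) sqrt Q) times a bounded
  numerator is left. Q is the sum of (a2^2 - a1^2) |1 - t^2| and of a nonnegative term that vanishes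
  with m. Dropping the latter gives a bound uniform in small \<open>b2\<close>; the price is the
  singularity at |t| = 1, that is, over |v| = a1 a2, where the boundaries of the two ellipses cross.
  The integral over \<open>D1\<close> vanishes because its range of t shrinks to nothing as
  \<open>a2\<close> tends to 1. The sign \<open>s\<close> enters only through the summand s / 2 of
  the kernel, which the Jacobian sends to 0, so both kernels have the same limits.\<close>

section \<open>Fiberwise change of variables and product integrals in the plane\<close>

lemma borel_measurable_plane:
  "f \<in> borel_measurable borel" if "f \<in> borel_measurable (borel \<Otimes>\<^sub>M borel)"
  for f :: "real \<times> real \<Rightarrow> 'b::topological_space"
  using that by (simp add: borel_prod)

text \<open>On each fiber the map is a one-dimensional dilation, so Tonelli and the affine
  substitution in each variable suffice. Only measurability of \<open>r\<close> enters, which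
  matters because \<open>fiber_radius\<close> has a kink at |t| = 1 and jumps where
  \<open>a2\<close> |t| = 1.\<close>

lemma distr_density_fiberwise_scaling:
  fixes c :: real and r :: "real \<Rightarrow> real"
  assumes c: "0 < c" and r_pos: "\<And>t. 0 < r t" and r [measurable]: "r \<in> borel_measurable borel"
  shows "distr (density lborel (\<lambda>(t, w). ennreal (c * r t))) lborel (\<lambda>(t, w). (c * t, r t * w))
         = (lborel :: (real \<times> real) measure)"
proof (rule measure_eqI)
  fix A :: "(real \<times> real) set"
  let ?T = "\<lambda>(t, w). (c * t, r t * w)"
  let ?J = "\<lambda>(t, w :: real). ennreal (c * r t)"
  assume "A \<in> sets (distr (density lborel ?J) lborel ?T)"
  then have [measurable]: "A \<in> sets borel" by simp
  have [measurable]: "?T \<in> borel_measurable borel"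
    by (rule borel_measurable_plane) measurable
  have [measurable]: "?J \<in> borel_measurable borel"
    by (rule borel_measurable_plane) measurable
  have A': "A \<in> sets (borel \<Otimes>\<^sub>M borel)" unfolding borel_prod by measurable
  note A'[measurable]
  have inner: "(\<integral>\<^sup>+w. ennreal (c * r t) * indicator A (c * t, r t * w) \<partial>lborel)
      = ennreal c * (\<integral>\<^sup>+u. indicator A (c * t, u) \<partial>lborel)" for t
  proof -
    have [measurable]: "(\<lambda>u. indicator A (c * t, u) :: ennreal) \<in> borel_measurable borel"
      by measurable
    have "(\<integral>\<^sup>+u. indicator A (c * t, u) \<partial>lborel)
        = ennreal (r t) * (\<integral>\<^sup>+w. indicator A (c * t, r t * w) \<partial>lborel)"
      using nn_integral_real_affine[of "\<lambda>u. indicator A (c * t, u)" "r t" 0] r_pos[of t] by simp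
    then show ?thesis
      using c r_pos[of t] by (simp add: nn_integral_cmult ennreal_mult' mult.assoc less_imp_le)
  qed
  have "emeasure (distr (density lborel ?J) lborel ?T) A
      = (\<integral>\<^sup>+z. ?J z * indicator A (?T z) \<partial>lborel)"
  proof -
    have *: "?T -` A \<in> sets borel"
      using measurable_sets[of ?T borel borel A] by simp
    show ?thesis
      by (subst emeasure_distr, simp, simp, subst emeasure_density)
         (auto intro!: nn_integral_cong simp: indicator_def *)
  qed
  also have "\<dots> = (\<integral>\<^sup>+t. \<integral>\<^sup>+w. ennreal (c * r t) * indicator A (c * t, r t * w) \<partial>lborel \<partial>lborel)"
    unfolding lborel_prod[symmetric] by (subst lborel.nn_integral_fst[symmetric]) auto
  also have "\<dots> = ennreal c * (\<integral>\<^sup>+t. \<integral>\<^sup>+u. indicator A (c * t, u) \<partial>lborel \<partial>lborel)"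
    unfolding inner by (rule nn_integral_cmult) measurable
  also have "\<dots> = (\<integral>\<^sup>+v. \<integral>\<^sup>+u. indicator A (v, u) \<partial>lborel \<partial>lborel)"
    using c nn_integral_real_affine[of "\<lambda>v. \<integral>\<^sup>+u. indicator A (v, u) \<partial>lborel" c 0] by simp
  also have "\<dots> = emeasure lborel A"
    unfolding lborel_prod[symmetric] by (subst lborel.nn_integral_fst) auto
  finally show "emeasure (distr (density lborel ?J) lborel ?T) A = emeasure lborel A" .
qed simp

lemma lborel_fiberwise_scaling:
  fixes c :: real and r :: "real \<Rightarrow> real" and f :: "real \<times> real \<Rightarrow> real"
  assumes c: "0 < c" and r_pos: "\<And>t. 0 < r t" and r [measurable]: "r \<in> borel_measurable borel"
    and f [measurable]: "f \<in> borel_measurable borel"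
  shows "integrable lborel f \<longleftrightarrow>
           integrable lborel (\<lambda>(t, w). c * r t * f (c * t, r t * w))" (is ?int)
    and "integral\<^sup>L lborel f = (\<integral>(t, w). c * r t * f (c * t, r t * w) \<partial>lborel)" (is ?eq)
proof -
  let ?T = "\<lambda>(t, w). (c * t, r t * w)"
  let ?J = "\<lambda>(t, w :: real). c * r t"
  have [measurable]: "?T \<in> borel_measurable borel"
    by (rule borel_measurable_plane) measurable
  have [measurable]: "?J \<in> borel_measurable borel"
    by (rule borel_measurable_plane) measurable
  have lb: "lborel = distr (density lborel (\<lambda>z. ennreal (?J z))) lborel ?T"
    using distr_density_fiberwise_scaling[OF c r_pos r] by (simp add: case_prod_beta')
  have J: "AE z in lborel. 0 \<le> ?J z"
    using c r_pos by (auto simp: case_prod_beta' less_imp_le)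
  have eq: "(\<lambda>z. ?J z *\<^sub>R f (?T z)) = (\<lambda>(t, w). c * r t * f (c * t, r t * w))"
    by auto
  show ?int
    by (subst lb, subst integrable_distr_eq, simp, simp, subst integrable_density)
       (use J eq in auto)
  show ?eq
    by (subst lb, subst integral_distr, simp, simp, subst integral_density)
       (use J eq in auto)
qed

lemma
  fixes f g :: "real \<Rightarrow> real"
  assumes f: "integrable lborel f" and g: "integrable lborel g"
  shows integrable_lborel_prod_mult: "integrable lborel (\<lambda>(x, y). f x * g y)"
    and integral_lborel_prod_mult:
      "(\<integral>(x, y). f x * g y \<partial>lborel) = integral\<^sup>L lborel f * integral\<^sup>L lborel g"
proof -
  have [measurable]: "f \<in> borel_measurable borel" "g \<in> borel_measurable borel"
    using f g by (simp_all add: borel_measurable_integrable[of lborel, simplified])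
  have int: "integrable (lborel \<Otimes>\<^sub>M lborel) (\<lambda>(x, y). f x * g y)"
    by (rule lborel_pair.Fubini_integrable)
       (use f g in \<open>auto simp: abs_mult intro!: integrable_mult_left\<close>)
  then show "integrable lborel (\<lambda>(x, y). f x * g y)"
    by (simp add: lborel_prod)
  show "(\<integral>(x, y). f x * g y \<partial>lborel) = integral\<^sup>L lborel f * integral\<^sup>L lborel g"
    using lborel_pair.integral_fst'[OF int] by (simp add: lborel_prod)
qed

text \<open>Serves to discard the lines t = 1 and t = -1: there the majorant is a quotient by
  \<open>sqrt 0\<close>, hence 0 by the convention for division, and bounds nothing.\<close>

lemma AE_lborel_fst_neq: "AE z in (lborel :: (real \<times> real) measure). fst z \<noteq> c"
  unfolding lborel_prod[symmetric]
proof (rule lborel_pair.AE_pair_measure)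
  show "{z \<in> space (lborel \<Otimes>\<^sub>M lborel). fst (z :: real \<times> real) \<noteq> c} \<in> sets (lborel \<Otimes>\<^sub>M lborel)"
    by measurable
  show "AE x in lborel. AE y in (lborel :: real measure). fst (x, y) \<noteq> c"
    using AE_lborel_singleton[of c] by eventually_elim simp
qed

section \<open>Integrability of inverse square root singularities\<close>

text \<open>The integrand is unbounded at both ends. Since it is nonnegative, the fundamental
  theorem with one-sided limits of \<open>arcsin\<close> yields integrability together with the
  value.\<close>

lemma has_bochner_integral_arcsin_deriv:
  "has_bochner_integral lborel (\<lambda>x. indicator {-1<..<1} x / sqrt (1 - x\<^sup>2)) pi"
proof -
  have pos: "0 < 1 - x\<^sup>2" if "-1 < x" "x < 1" for x :: real
    using that by (simp add: abs_square_less_1 abs_less_iff)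
  have "(arcsin \<longlongrightarrow> arcsin (-1)) (at_right (-1))" "(arcsin \<longlongrightarrow> arcsin 1) (at_left 1)"
    using continuous_on_Icc_at_rightD[OF continuous_on_arcsin'] continuous_on_Icc_at_leftD[OF continuous_on_arcsin']
    by auto
  then have lims: "((arcsin \<circ> real_of_ereal) \<longlongrightarrow> arcsin (-1)) (at_right (ereal (-1)))"
             "((arcsin \<circ> real_of_ereal) \<longlongrightarrow> arcsin 1) (at_left (ereal 1))"
    unfolding ereal_tendsto_simps by auto
  note FTC = interval_integral_FTC_nonneg[of "ereal (-1)" "ereal 1" arcsin
      "\<lambda>x. inverse (sqrt (1 - x\<^sup>2))" "arcsin (-1)" "arcsin 1"]
  have sq: "x\<^sup>2 \<noteq> 1" if "-1 < x" "x < 1" for x :: real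
    using pos[OF that] by auto
  have D: "DERIV arcsin x :> inverse (sqrt (1 - x\<^sup>2))" "isCont (\<lambda>x. inverse (sqrt (1 - x\<^sup>2))) x"
    if "ereal (-1) < ereal x" "ereal x < ereal 1" for x
    using that sq by (auto intro!: DERIV_arcsin continuous_intros)
  have nonneg: "AE x in lborel. ereal (-1) < ereal x \<longrightarrow> ereal x < ereal 1 \<longrightarrow> 0 \<le> inverse (sqrt (1 - x\<^sup>2))"
    using pos by (simp add: less_imp_le)
  have "set_integrable lborel {-1<..<1} (\<lambda>x::real. inverse (sqrt (1 - x\<^sup>2)))"
    using FTC(1)[OF _ D nonneg lims] by simp
  moreover have "(LBINT x=ereal (-1)..ereal 1. inverse (sqrt (1 - x\<^sup>2))) = pi"
    using FTC(2)[OF _ D nonneg lims] by simp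
  ultimately show ?thesis
    by (auto simp: has_bochner_integral_iff set_integrable_def interval_lebesgue_integral_def
        set_lebesgue_integral_def divide_inverse)
qed

lemma integrable_inverse_sqrt_abs:
  "integrable lborel (\<lambda>x. indicator {-R<..<R} x / sqrt \<bar>x\<bar>)" for R :: real
proof (cases "0 < R")
  case True
  have "((\<lambda>x. 2 * sqrt x) \<longlongrightarrow> 2 * sqrt 0) (at_right 0)" "((\<lambda>x. 2 * sqrt x) \<longlongrightarrow> 2 * sqrt R) (at_left R)"
    by (intro tendsto_intros)+
  then have lims: "(((\<lambda>x. 2 * sqrt x) \<circ> real_of_ereal) \<longlongrightarrow> 2 * sqrt 0) (at_right (ereal 0))"
      "(((\<lambda>x. 2 * sqrt x) \<circ> real_of_ereal) \<longlongrightarrow> 2 * sqrt R) (at_left (ereal R))"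
    unfolding ereal_tendsto_simps by auto
  have "set_integrable lborel (einterval (ereal 0) (ereal R)) (\<lambda>x::real. inverse (sqrt x))"
    by (rule interval_integral_FTC_nonneg(1)[OF _ _ _ _ lims])
       (use True in \<open>auto intro!: derivative_eq_intros continuous_intros simp: field_simps\<close>)
  then have pos: "integrable lborel (\<lambda>x::real. indicator {0<..<R} x / sqrt x)"
    by (simp add: set_integrable_def divide_inverse)
  have "integrable lborel (\<lambda>x::real. indicator {0<..<R} x / sqrt x + indicator {0<..<R} (-x) / sqrt (-x))"
    using pos lborel_integrable_real_affine[OF pos, of "-1" 0]
    by (intro Bochner_Integration.integrable_add) auto
  \<comment> \<open>The equality holds even at x = 0, where the right side is a quotient by
    \<open>sqrt 0\<close> and so is 0.\<close>
  also have "(\<lambda>x::real. indicator {0<..<R} x / sqrt x + indicator {0<..<R} (-x) / sqrt (-x))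
     = (\<lambda>x. indicator {-R<..<R} x / sqrt \<bar>x\<bar>)"
    by (auto simp: indicator_def fun_eq_iff)
  finally show ?thesis .
qed auto

text \<open>In |1 - x^2| = |x - 1| |x + 1| the factor belonging to the root on the other side of 0
  is at least 1, so the other factor alone bounds the product from below. The sum of two translates
  of 1 / sqrt |x| therefore dominates.\<close>

lemma integrable_inverse_sqrt_abs_one_minus_square:
  "integrable lborel (\<lambda>x. indicator {-R..R} x / sqrt \<bar>1 - x\<^sup>2\<bar>)" for R :: real
proof (rule Bochner_Integration.integrable_bound)
  \<comment> \<open>The margin 2 keeps x - 1 and x + 1 inside the open interval whenever |x| is at
    most \<open>R\<close>.\<close>
  let ?g = "\<lambda>x. indicator {-(R+2)<..<R+2} x / sqrt \<bar>x\<bar>"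
  have g: "integrable lborel ?g" by (rule integrable_inverse_sqrt_abs)
  show "integrable lborel (\<lambda>x. ?g (x - 1) + ?g (x + 1))"
    using lborel_integrable_real_affine[OF g, of 1 "-1"] lborel_integrable_real_affine[OF g, of 1 1]
    by (intro Bochner_Integration.integrable_add) (auto simp: add.commute)
  have "1 / sqrt \<bar>1 - x\<^sup>2\<bar> \<le> 1 / sqrt \<bar>x - 1\<bar> + 1 / sqrt \<bar>x + 1\<bar>" for x :: real
  proof (cases "\<bar>x\<bar> = 1")
    case True
    then have "x\<^sup>2 = 1" by (simp add: power2_eq_1_iff abs_if split: if_splits)
    then show ?thesis by simp
  next
    case False
    have *: "\<bar>1 - x\<^sup>2\<bar> = \<bar>x - 1\<bar> * \<bar>x + 1\<bar>"
      by (simp add: power2_eq_square algebra_simps flip: abs_mult) 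
    have nz: "\<bar>x - 1\<bar> > 0" "\<bar>x + 1\<bar> > 0" using False by auto
    show ?thesis
    proof (cases "x \<ge> 0")
      case True
      then have "\<bar>x - 1\<bar> \<le> \<bar>1 - x\<^sup>2\<bar>"
        unfolding * using mult_left_mono[of 1 "\<bar>x + 1\<bar>" "\<bar>x - 1\<bar>"] by simp
      then have "1 / sqrt \<bar>1 - x\<^sup>2\<bar> \<le> 1 / sqrt \<bar>x - 1\<bar>"
        using nz by (intro divide_left_mono) (auto simp: *)
      then show ?thesis by (simp add: add_increasing2)
    next
      case False
      then have "\<bar>x + 1\<bar> \<le> \<bar>1 - x\<^sup>2\<bar>"
        unfolding * using mult_right_mono[of 1 "\<bar>x - 1\<bar>" "\<bar>x + 1\<bar>"] by simp
      then have "1 / sqrt \<bar>1 - x\<^sup>2\<bar> \<le> 1 / sqrt \<bar>x + 1\<bar>"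
        using nz by (intro divide_left_mono) (auto simp: *)
      then show ?thesis by (simp add: add_increasing)
    qed
  qed
  then show "AE x in lborel. norm (indicator {-R..R} x / sqrt \<bar>1 - x\<^sup>2\<bar>) \<le> norm (?g (x - 1) + ?g (x + 1))"
    by (auto simp: indicator_def)
qed measurable

section \<open>The two ellipses and the support of the kernel\<close>

lemma admissibleD:
  assumes "admissible a1 b1 a2 b2"
  shows "0 < a1" "a1 < a2" "0 < a2" "a1 < 1" "a2 < 1" "0 < b1" "0 < b2" "b1 < 1" "b2 < 1"
    "b1\<^sup>2 = 1 - a1\<^sup>2" "b2\<^sup>2 = 1 - a2\<^sup>2" "0 < a2\<^sup>2 - a1\<^sup>2"
proof -
  have *: "0 < a1" "a1 < a2" "a2 < 1" and b: "b1 = sqrt (1 - a1\<^sup>2)" "b2 = sqrt (1 - a2\<^sup>2)"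
    using assms by (auto simp: admissible_def)
  show "0 < a1" "a1 < a2" "0 < a2" "a1 < 1" "a2 < 1" using * by auto
  then have "a1\<^sup>2 < 1" "a2\<^sup>2 < 1" "0 < a1\<^sup>2" "0 < a2\<^sup>2"
    by (auto simp: power_less_one_iff)
  then show "0 < b1" "0 < b2" "b1 < 1" "b2 < 1" "b1\<^sup>2 = 1 - a1\<^sup>2" "b2\<^sup>2 = 1 - a2\<^sup>2"
    by (auto simp: b)
  show "0 < a2\<^sup>2 - a1\<^sup>2" using * by (simp add: power_strict_mono)
qed

text \<open>Over \<open>v = a\<^sub>1 a\<^sub>2 t\<close> one has \<open>r\<^sub>1 = b\<^sub>1 \<surd>(1 - (a\<^sub>2 t)\<^sup>2)\<close> and
  \<open>r\<^sub>2 = b\<^sub>2 \<surd>(1 - (a\<^sub>1 t)\<^sup>2)\<close>, so this is the half-width of the fiber of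
  the intersection of the two ellipses; the value \<open>1\<close> where that fiber is degenerate keeps the
  substitution below invertible.\<close>

definition fiber_radius :: "real \<Rightarrow> real \<Rightarrow> real \<Rightarrow> real \<Rightarrow> real \<Rightarrow> real" where
  "fiber_radius a1 b1 a2 b2 t =
     (if a2 * \<bar>t\<bar> < 1 then min (b1 * sqrt (1 - (a2 * t)\<^sup>2)) (b2 * sqrt (1 - (a1 * t)\<^sup>2)) else 1)"

lemma abs_mult_less_one_square: "a * \<bar>t\<bar> < 1 \<Longrightarrow> 0 < a \<Longrightarrow> (a * t)\<^sup>2 < 1" for a t :: real
  by (simp add: abs_square_less_1 abs_mult)

lemma fiber_radius_pos:
  assumes "admissible a1 b1 a2 b2"
  shows "0 < fiber_radius a1 b1 a2 b2 t"
proof -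
  note D = admissibleD[OF assms]
  have "(a2 * t)\<^sup>2 < 1 \<and> (a1 * t)\<^sup>2 < 1" if "a2 * \<bar>t\<bar> < 1"
  proof -
    have "a1 * \<bar>t\<bar> \<le> a2 * \<bar>t\<bar>" using D by (intro mult_right_mono) auto
    then show ?thesis using that D by (auto intro!: abs_mult_less_one_square)
  qed
  then show ?thesis using D by (auto simp: fiber_radius_def)
qed

lemma borel_measurable_fiber_radius [measurable]:
  "fiber_radius a1 b1 a2 b2 \<in> borel_measurable borel"
  unfolding fiber_radius_def[abs_def] by measurable

text \<open>Outside an ellipse the indicator is 0; on its boundary the denominator is 0, and so is
  the quotient. Only points where both \<open>F_ell\<close> are positive remain to be
  examined.\<close>

lemma K_fun_eq_0:
  assumes "F_ell a1 b1 z \<le> 0 \<or> F_ell a2 b2 z \<le> 0"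
  shows "K_fun s a1 b1 a2 b2 z = 0"
  using assms by (auto simp: K_fun_def E_ell_def indicator_def)

lemma F_ell_pos_imp:
  assumes "0 < a" "0 < b" "0 < F_ell a b (v, u)"
  shows "\<bar>v\<bar> < a" "\<bar>u\<bar> < r_ell a b v"
proof -
  have *: "v\<^sup>2 / a\<^sup>2 + u\<^sup>2 / b\<^sup>2 < 1" using assms by (simp add: F_ell_def)
  have "0 \<le> u\<^sup>2 / b\<^sup>2" by simp
  with * have "v\<^sup>2 / a\<^sup>2 < 1" by linarith
  then have v: "v\<^sup>2 < a\<^sup>2" using assms by (simp add: field_simps)
  then show "\<bar>v\<bar> < a" using assms power2_less_imp_less[of "\<bar>v\<bar>" a] by simp
  have "u\<^sup>2 < (b / a)\<^sup>2 * (a\<^sup>2 - v\<^sup>2)"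
    using * assms by (simp add: field_simps)
  then have "sqrt (u\<^sup>2) < sqrt ((b / a)\<^sup>2 * (a\<^sup>2 - v\<^sup>2))" by (rule real_sqrt_less_mono)
  then show "\<bar>u\<bar> < r_ell a b v"
    using assms by (simp add: r_ell_def real_sqrt_mult)
qed

text \<open>Where the kernel is nonzero, positivity of both \<open>F_ell\<close> already implies the
  bounds on |u| and the upper bound on |v|. The region thus becomes a condition on v alone, which
  the fiberwise substitution respects.\<close>

lemma K_fun_on_D1:
  assumes "admissible a1 b1 a2 b2"
  shows "indicator (D1 a1 b1 a2 b2) (v, u) * K_fun s a1 b1 a2 b2 (v, u) =
    indicator {v. a1 * a2 < \<bar>v\<bar>} v * K_fun s a1 b1 a2 b2 (v, u)"
proof (cases "F_ell a1 b1 (v, u) > 0 \<and> F_ell a2 b2 (v, u) > 0")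
  case True
  then show ?thesis
    using F_ell_pos_imp[of a1 b1 v u] admissibleD[OF assms] by (auto simp: indicator_def D1_def)
next
  case False
  then show ?thesis using K_fun_eq_0[of a1 b1 "(v, u)" a2 b2 s] by (auto simp: not_less)
qed

lemma K_fun_on_D2:
  assumes "admissible a1 b1 a2 b2"
  shows "indicator (D2 a1 b1 a2 b2) (v, u) * K_fun s a1 b1 a2 b2 (v, u) =
    indicator {v. \<bar>v\<bar> \<le> a1 * a2} v * K_fun s a1 b1 a2 b2 (v, u)"
proof (cases "F_ell a1 b1 (v, u) > 0 \<and> F_ell a2 b2 (v, u) > 0")
  case True
  then show ?thesis
    using F_ell_pos_imp[of a2 b2 v u] admissibleD[OF assms] by (auto simp: indicator_def D2_def)
next
  case False
  then show ?thesis using K_fun_eq_0[of a1 b1 "(v, u)" a2 b2 s] by (auto simp: not_less)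
qed

section \<open>The kernel in rescaled coordinates and its majorant\<close>

text \<open>The prefactor of \<open>F0\<close> has the common numerator of \<open>a0_sq\<close> and
  \<open>b0_sq\<close>, which cancels.\<close>

lemma F0_eq:
  assumes "admissible a1 b1 a2 b2"
  shows "F0 a1 b1 a2 b2 (v, u) =
    ((a1 * b2)\<^sup>2 + (a2 * b1)\<^sup>2 - v\<^sup>2 * (b1\<^sup>2 + b2\<^sup>2) - u\<^sup>2 * (a1\<^sup>2 + a2\<^sup>2)) / (2 * (a1 * a2) * (b1 * b2))"
proof -
  define N where "N = (a1 * b2)\<^sup>2 + (a2 * b1)\<^sup>2"
  have N: "N \<noteq> 0" using admissibleD[OF assms] by (simp add: N_def)
  show ?thesis
    using N by (simp add: F0_def a0_sq_def b0_sq_def N_def[symmetric] right_diff_distrib)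
       (simp add: divide_simps)
qed

text \<open>By \<open>F0_eq\<close>, this is 2 (a1 a2) (b1 b2) times \<open>F0\<close> at the
  rescaled point.\<close>

definition kernel_num :: "real \<Rightarrow> real \<Rightarrow> real \<Rightarrow> real \<Rightarrow> real \<Rightarrow> real \<Rightarrow> real" where
  "kernel_num a1 b1 a2 b2 t w = (a1 * b2)\<^sup>2 + (a2 * b1)\<^sup>2 - (a1 * a2 * t)\<^sup>2 * (b1\<^sup>2 + b2\<^sup>2)
     - (fiber_radius a1 b1 a2 b2 t * w)\<^sup>2 * (a1\<^sup>2 + a2\<^sup>2)"

text \<open>For \<open>a2\<close> |t| < 1 this is the squared half-width of the wider fiber minus
  u^2, where u = m w, split into (wider^2 - m^2) + m^2 (1 - w^2).\<close>

definition kernel_den :: "real \<Rightarrow> real \<Rightarrow> real \<Rightarrow> real \<Rightarrow> real \<Rightarrow> real \<Rightarrow> real" where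
  "kernel_den a1 b1 a2 b2 t w = (a2\<^sup>2 - a1\<^sup>2) * \<bar>1 - t\<^sup>2\<bar> + (fiber_radius a1 b1 a2 b2 t)\<^sup>2 * (1 - w\<^sup>2)"

text \<open>The factor \<open>1 - w\<^sup>2\<close> comes from the ellipse bounding the fiber, and \<open>kernel_den\<close> from the
  other one: \<open>r\<^sub>2\<^sup>2 - r\<^sub>1\<^sup>2 = (a\<^sub>2\<^sup>2 - a\<^sub>1\<^sup>2) (t\<^sup>2 - 1)\<close>.\<close>

lemma K_fun_scaled:
  assumes adm: "admissible a1 b1 a2 b2" and t: "a2 * \<bar>t\<bar> < 1" and w: "\<bar>w\<bar> < 1"
  defines "m \<equiv> fiber_radius a1 b1 a2 b2 t"
  shows "a1 * a2 * m * K_fun s a1 b1 a2 b2 (a1 * a2 * t, m * w) =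
    kernel_num a1 b1 a2 b2 t w / (4 * sqrt (1 - w\<^sup>2) * sqrt (kernel_den a1 b1 a2 b2 t w))
      + s * a1 * a2 * m / 2"
proof -
  note D = admissibleD[OF adm]
  define z where "z = (a1 * a2 * t, m * w)"
  define Q where "Q = kernel_den a1 b1 a2 b2 t w"
  define P where "P = kernel_num a1 b1 a2 b2 t w"
  have m: "0 < m" using fiber_radius_pos[OF adm] by (simp add: m_def)
  have w2: "0 < 1 - w\<^sup>2" using w by (simp add: abs_square_less_1)
  have "a1 * \<bar>t\<bar> \<le> a2 * \<bar>t\<bar>" using D by (intro mult_right_mono) auto
  then have at: "(a2 * t)\<^sup>2 < 1" "(a1 * t)\<^sup>2 < 1"
    using t D by (auto intro!: abs_mult_less_one_square)
  define X1 X2 where "X1 = b1\<^sup>2 * (1 - (a2 * t)\<^sup>2)" and "X2 = b2\<^sup>2 * (1 - (a1 * t)\<^sup>2)"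
  have m_eq: "m = min (sqrt X1) (sqrt X2)"
    using t D(6,7) by (simp add: m_def fiber_radius_def X1_def X2_def real_sqrt_mult)
  have X: "0 < X1" "0 < X2" using at D(6,7) by (auto simp: X1_def X2_def)
  have m2: "m\<^sup>2 = min X1 X2"
    using X by (auto simp: m_eq min_def)
  have diff: "X2 - X1 = (a2\<^sup>2 - a1\<^sup>2) * (t\<^sup>2 - 1)"
    unfolding X1_def X2_def by (simp add: D(10,11) power_mult_distrib) algebra
  have F1: "b1\<^sup>2 * F_ell a1 b1 z = X1 - m\<^sup>2 * w\<^sup>2" and F2: "b2\<^sup>2 * F_ell a2 b2 z = X2 - m\<^sup>2 * w\<^sup>2"
    using D(1,3,6,7) by (simp_all add: F_ell_def z_def X1_def X2_def power_mult_distrib field_simps)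
  have prod: "b1\<^sup>2 * F_ell a1 b1 z * (b2\<^sup>2 * F_ell a2 b2 z) = m\<^sup>2 * (1 - w\<^sup>2) * Q"
    and pos: "0 < b1\<^sup>2 * F_ell a1 b1 z" "0 < b2\<^sup>2 * F_ell a2 b2 z"
  proof -
    have mw: "0 < m\<^sup>2 * (1 - w\<^sup>2)" using m w2 by simp
    \<comment> \<open>By \<open>diff\<close> the cases are |t| >= 1 and |t| <= 1. The ellipse with
      the narrower fiber contributes m^2 (1 - w^2), the other one Q.\<close>
    consider "X1 \<le> X2" | "X2 \<le> X1" by linarith
    then have "b1\<^sup>2 * F_ell a1 b1 z * (b2\<^sup>2 * F_ell a2 b2 z) = m\<^sup>2 * (1 - w\<^sup>2) * Q \<and>
       0 < b1\<^sup>2 * F_ell a1 b1 z \<and> 0 < b2\<^sup>2 * F_ell a2 b2 z"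
    proof cases
      case 1
      then have mX: "m\<^sup>2 = X1" by (simp add: m2)
      have "0 \<le> (a2\<^sup>2 - a1\<^sup>2) * (t\<^sup>2 - 1)" using 1 diff by simp
      then have "0 \<le> t\<^sup>2 - 1" using D(12) by (simp add: zero_le_mult_iff)
      then have "Q = X2 - X1 + m\<^sup>2 * (1 - w\<^sup>2)" by (simp add: Q_def kernel_den_def m_def diff)
      then have "b2\<^sup>2 * F_ell a2 b2 z = Q" "b1\<^sup>2 * F_ell a1 b1 z = m\<^sup>2 * (1 - w\<^sup>2)" "Q > 0"
        using F1 F2 mw 1 mX by (auto simp: algebra_simps)
      then show ?thesis using mw by simp
    next
      case 2
      then have mX: "m\<^sup>2 = X2" by (simp add: m2)
      have "(a2\<^sup>2 - a1\<^sup>2) * (t\<^sup>2 - 1) \<le> 0" using 2 diff by simp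
      then have "t\<^sup>2 - 1 \<le> 0" using D(12) by (simp add: mult_le_0_iff)
      then have "Q = X1 - X2 + m\<^sup>2 * (1 - w\<^sup>2)"
        using diff by (simp add: Q_def kernel_den_def m_def algebra_simps)
      then have "b1\<^sup>2 * F_ell a1 b1 z = Q" "b2\<^sup>2 * F_ell a2 b2 z = m\<^sup>2 * (1 - w\<^sup>2)" "Q > 0"
        using F1 F2 mw 2 mX by (auto simp: algebra_simps)
      then show ?thesis using mw by simp
    qed
    then show "b1\<^sup>2 * F_ell a1 b1 z * (b2\<^sup>2 * F_ell a2 b2 z) = m\<^sup>2 * (1 - w\<^sup>2) * Q"
      "0 < b1\<^sup>2 * F_ell a1 b1 z" "0 < b2\<^sup>2 * F_ell a2 b2 z" by auto
  qed
  have Fpos: "0 < F_ell a1 b1 z" "0 < F_ell a2 b2 z"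
    using pos D(6,7) by (auto simp: zero_less_mult_iff)
  define R where "R = sqrt (F_ell a1 b1 z * F_ell a2 b2 z)"
  have R: "0 < R" using Fpos by (simp add: R_def)
  have "sqrt ((b1 * b2)\<^sup>2 * (F_ell a1 b1 z * F_ell a2 b2 z)) = sqrt (m\<^sup>2 * (1 - w\<^sup>2) * Q)"
    using prod by (simp add: power_mult_distrib mult_ac)
  \<comment> \<open>This trades the product b1 b2 in the denominator of \<open>F0\<close>, which
    tends to 0, for the factor m of the Jacobian.\<close>
  then have R_eq: "b1 * b2 * R = m * sqrt (1 - w\<^sup>2) * sqrt Q"
    using D m by (simp add: real_sqrt_mult R_def)
  have F0: "F0 a1 b1 a2 b2 z = P / (2 * (a1 * a2) * (b1 * b2))"
    by (simp add: z_def F0_eq[OF adm] P_def kernel_num_def m_def)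
  have "K_fun s a1 b1 a2 b2 z = (F0 a1 b1 a2 b2 z + s * R) / (2 * R)"
    using Fpos by (simp add: K_fun_def E_ell_def R_def)
  also have "\<dots> = P / (4 * (a1 * a2) * (b1 * b2 * R)) + s / 2"
    using R D by (simp add: F0 field_simps)
  finally have "a1 * a2 * m * K_fun s a1 b1 a2 b2 z
      = a1 * a2 * m * (P / (4 * (a1 * a2) * (m * sqrt (1 - w\<^sup>2) * sqrt Q)) + s / 2)"
    by (simp add: R_eq)
  also have "\<dots> = P / (4 * sqrt (1 - w\<^sup>2) * sqrt Q) + s * a1 * a2 * m / 2"
    using m D by (simp add: distrib_left field_simps)
  finally show ?thesis by (simp add: z_def P_def Q_def)
qed

lemma fiber_radius_le_1:
  assumes adm: "admissible a1 b1 a2 b2"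
  shows "fiber_radius a1 b1 a2 b2 t \<le> 1"
proof (cases "a2 * \<bar>t\<bar> < 1")
  case True
  note D = admissibleD[OF adm]
  have "(a2 * t)\<^sup>2 \<le> 1"
    using True D by (intro less_imp_le abs_mult_less_one_square) auto
  then have "b1 * sqrt (1 - (a2 * t)\<^sup>2) \<le> 1 * 1" using D(6,8) by (intro mult_mono) auto
  then show ?thesis using True by (simp add: fiber_radius_def min_le_iff_disj)
qed (simp add: fiber_radius_def)

text \<open>The constant is 1 + 1 + 2 + 2, a term by term bound that ignores cancellation.\<close>

lemma abs_kernel_num_le:
  assumes adm: "admissible a1 b1 a2 b2" and t: "a2 * \<bar>t\<bar> < 1" and w: "\<bar>w\<bar> < 1"
  shows "\<bar>kernel_num a1 b1 a2 b2 t w\<bar> \<le> 6"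
proof -
  note D = admissibleD[OF adm]
  have le1: "x\<^sup>2 \<le> 1" if "\<bar>x\<bar> \<le> 1" for x :: real
    using that by (simp add: abs_square_le_1)
  have mult1: "\<bar>x * y\<bar> \<le> 1" if "\<bar>x\<bar> \<le> 1" "\<bar>y\<bar> \<le> 1" for x y :: real
    using mult_mono[OF that] by (simp add: abs_mult)
  have "(a1 * b2)\<^sup>2 \<le> 1" "(a2 * b1)\<^sup>2 \<le> 1" using D by (auto intro!: le1 mult1)
  moreover have at: "(a1 * a2 * t)\<^sup>2 \<le> 1"
    using D t mult1[of a1 "a2 * t"] by (intro le1) (simp add: abs_mult mult.assoc)
  moreover have mw: "(fiber_radius a1 b1 a2 b2 t * w)\<^sup>2 \<le> 1"
    using fiber_radius_le_1[OF adm, of t] w fiber_radius_pos[OF adm, of t] by (intro le1 mult1) auto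
  moreover have b: "b1\<^sup>2 + b2\<^sup>2 \<le> 2" and a: "a1\<^sup>2 + a2\<^sup>2 \<le> 2"
    using le1[of b1] le1[of b2] le1[of a1] le1[of a2] D by auto
  moreover have "(a1 * a2 * t)\<^sup>2 * (b1\<^sup>2 + b2\<^sup>2) \<le> 1 * 2"
    using at b by (intro mult_mono) auto
  moreover have "(fiber_radius a1 b1 a2 b2 t * w)\<^sup>2 * (a1\<^sup>2 + a2\<^sup>2) \<le> 1 * 2"
    using mw a by (intro mult_mono) auto
  moreover have "0 \<le> (a1 * a2 * t)\<^sup>2 * (b1\<^sup>2 + b2\<^sup>2)"
    "0 \<le> (fiber_radius a1 b1 a2 b2 t * w)\<^sup>2 * (a1\<^sup>2 + a2\<^sup>2)"
    "0 \<le> (a1 * b2)\<^sup>2" "0 \<le> (a2 * b1)\<^sup>2"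
    by simp_all
  ultimately show "\<bar>kernel_num a1 b1 a2 b2 t w\<bar> \<le> 6"
    unfolding kernel_num_def abs_le_iff by linarith
qed

text \<open>If both \<open>F_ell\<close> were positive, |v| < a1 would give \<open>a2\<close> |t| <
  1, and u strictly inside both fibers would give |w| < 1. So the conventional value
  \<open>1\<close> of \<open>fiber_radius\<close> never meets a nonzero kernel.\<close>

lemma K_fun_scaled_eq_0:
  assumes adm: "admissible a1 b1 a2 b2" and "1 \<le> a2 * \<bar>t\<bar> \<or> 1 \<le> \<bar>w\<bar>"
  shows "K_fun s a1 b1 a2 b2 (a1 * a2 * t, fiber_radius a1 b1 a2 b2 t * w) = 0"
proof (rule K_fun_eq_0, rule disjCI, rule ccontr)
  note D = admissibleD[OF adm]
  let ?m = "fiber_radius a1 b1 a2 b2 t"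
  assume "\<not> F_ell a2 b2 (a1 * a2 * t, ?m * w) \<le> 0" "\<not> F_ell a1 b1 (a1 * a2 * t, ?m * w) \<le> 0"
  then have F: "\<bar>a1 * a2 * t\<bar> < a1" "\<bar>?m * w\<bar> < r_ell a1 b1 (a1 * a2 * t)"
      "\<bar>?m * w\<bar> < r_ell a2 b2 (a1 * a2 * t)"
    using F_ell_pos_imp[of a1 b1 "a1 * a2 * t" "?m * w"] F_ell_pos_imp[of a2 b2 "a1 * a2 * t" "?m * w"] D
    by auto
  then have t: "a2 * \<bar>t\<bar> < 1" using D by (simp add: abs_mult)
  have "a1\<^sup>2 - (a1 * a2 * t)\<^sup>2 = a1\<^sup>2 * (1 - (a2 * t)\<^sup>2)" "a2\<^sup>2 - (a1 * a2 * t)\<^sup>2 = a2\<^sup>2 * (1 - (a1 * t)\<^sup>2)"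
    by (simp_all add: power_mult_distrib right_diff_distrib mult_ac)
  then have "r_ell a1 b1 (a1 * a2 * t) = b1 * sqrt (1 - (a2 * t)\<^sup>2)"
    "r_ell a2 b2 (a1 * a2 * t) = b2 * sqrt (1 - (a1 * t)\<^sup>2)"
    using D(1,3) by (simp_all add: r_ell_def real_sqrt_mult)
  then have "\<bar>?m * w\<bar> < ?m" using F t by (simp add: fiber_radius_def)
  then have "\<bar>w\<bar> < 1" using fiber_radius_pos[OF adm, of t] by (simp add: abs_mult)
  with t show False using assms by auto
qed

text \<open>Dropping the second summand of \<open>kernel_den\<close> removes m from the estimate. In
  the constant, 3 / 2 is the bound 6 on \<open>kernel_num\<close> over the 4 of
  \<open>K_fun_scaled\<close>; the term with \<open>a2\<close> alone absorbs the summand carrying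
  \<open>s\<close>.\<close>

lemma abs_K_fun_scaled_le:
  assumes adm: "admissible a1 b1 a2 b2" and t1: "\<bar>t\<bar> \<noteq> 1" and s: "\<bar>s\<bar> \<le> 1" and R: "1 / a2 \<le> R"
  defines "m \<equiv> fiber_radius a1 b1 a2 b2 t"
  shows "\<bar>a1 * a2 * m * K_fun s a1 b1 a2 b2 (a1 * a2 * t, m * w)\<bar> \<le>
    (3 / (2 * sqrt (a2\<^sup>2 - a1\<^sup>2)) + 1 / (2 * a2)) *
      (indicator {-R..R} t / sqrt \<bar>1 - t\<^sup>2\<bar> * (indicator {-1<..<1} w / sqrt (1 - w\<^sup>2)))"
proof (cases "a2 * \<bar>t\<bar> < 1 \<and> \<bar>w\<bar> < 1")
  case False
  then have "K_fun s a1 b1 a2 b2 (a1 * a2 * t, m * w) = 0"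
    unfolding m_def by (intro K_fun_scaled_eq_0[OF adm]) auto
  then show ?thesis using admissibleD[OF adm] by (auto simp: indicator_def power_le_one_iff abs_square_le_1)
next
  case True
  note D = admissibleD[OF adm]
  let ?P = "kernel_num a1 b1 a2 b2 t w" and ?Q = "kernel_den a1 b1 a2 b2 t w"
  define W T A where "W = sqrt (1 - w\<^sup>2)" and "T = sqrt \<bar>1 - t\<^sup>2\<bar>" and "A = sqrt (a2\<^sup>2 - a1\<^sup>2)"
  have w2: "0 < 1 - w\<^sup>2" using True by (simp add: abs_square_less_1)
  have m: "0 < m" "m \<le> 1"
    using fiber_radius_pos[OF adm] fiber_radius_le_1[OF adm] by (auto simp: m_def)
  have "t\<^sup>2 \<noteq> 1" using t1 by (simp add: power2_eq_1_iff abs_if split: if_splits)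
  then have pos: "0 < W" "0 < T" "0 < A" using w2 D by (auto simp: W_def T_def A_def)
  have "A * T \<le> sqrt ?Q"
    unfolding A_def T_def real_sqrt_mult[symmetric] kernel_den_def using w2
    by (intro real_sqrt_le_mono) auto
  then have "4 * W * (A * T) \<le> 4 * W * sqrt ?Q" using pos by simp
  moreover have "0 < 4 * W * (A * T)" using pos by simp
  ultimately have "\<bar>?P\<bar> / (4 * W * sqrt ?Q) \<le> 6 / (4 * W * (A * T))"
    using abs_kernel_num_le[OF adm, of t w] True by (intro frac_le) auto
  \<comment> \<open>This summand is not singular and is at most 1 / 2. It fits under the singular
    majorant because a2 T W <= 1, where a2 T <= 1 since a2^2 and (a2 t)^2 both lie in
    [0, 1].\<close>
  moreover have "\<bar>s * a1 * a2 * m / 2\<bar> \<le> 1 / (2 * a2) / (T * W)"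
  proof -
    have "\<bar>s\<bar> * a1 * a2 * m \<le> 1 * 1 * 1 * 1"
      using s D m by (intro mult_mono) auto
    then have 1: "\<bar>s * a1 * a2 * m / 2\<bar> \<le> 1 / 2" using D m by (simp add: abs_mult)
    have "(a2 * t)\<^sup>2 < 1" using True D by (intro abs_mult_less_one_square) auto
    moreover have "a2\<^sup>2 \<le> 1" using D by (simp add: abs_square_le_1)
    moreover have "0 \<le> a2\<^sup>2" "0 \<le> (a2 * t)\<^sup>2" by simp_all
    moreover have "a2\<^sup>2 * (1 - t\<^sup>2) = a2\<^sup>2 - (a2 * t)\<^sup>2" by (simp add: power_mult_distrib algebra_simps)
    ultimately have "\<bar>a2\<^sup>2 * (1 - t\<^sup>2)\<bar> \<le> 1" by linarith
    then have "sqrt (a2\<^sup>2 * \<bar>1 - t\<^sup>2\<bar>) \<le> 1" by (simp add: abs_mult)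
    then have "a2 * T \<le> 1" using D by (simp add: T_def real_sqrt_mult)
    moreover have "W \<le> 1" by (simp add: W_def)
    ultimately have "a2 * T * W \<le> 1 * 1" using pos by (intro mult_mono) auto
    then have "1 / 2 \<le> 1 / (2 * a2) / (T * W)" using pos D by (simp add: field_simps)
    with 1 show ?thesis by linarith
  qed
  ultimately have le: "\<bar>?P\<bar> / (4 * W * sqrt ?Q) + \<bar>s * a1 * a2 * m / 2\<bar> \<le> 6 / (4 * W * (A * T)) + 1 / (2 * a2) / (T * W)"
    by linarith
  have "0 \<le> ?Q" using w2 D by (simp add: kernel_den_def)
  then have "\<bar>?P / (4 * W * sqrt ?Q)\<bar> = \<bar>?P\<bar> / (4 * W * sqrt ?Q)" using pos by (simp add: abs_mult abs_divide)
  then have "\<bar>?P / (4 * W * sqrt ?Q) + s * a1 * a2 * m / 2\<bar>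
      \<le> \<bar>?P\<bar> / (4 * W * sqrt ?Q) + \<bar>s * a1 * a2 * m / 2\<bar>"
    using abs_triangle_ineq[of "?P / (4 * W * sqrt ?Q)" "s * a1 * a2 * m / 2"] by (simp only:)
  then have "\<bar>a1 * a2 * m * K_fun s a1 b1 a2 b2 (a1 * a2 * t, m * w)\<bar>
      \<le> \<bar>?P\<bar> / (4 * W * sqrt ?Q) + \<bar>s * a1 * a2 * m / 2\<bar>"
    using K_fun_scaled[OF adm, of t w s] True by (simp only: m_def W_def)
  also note le
  also have "6 / (4 * W * (A * T)) + 1 / (2 * a2) / (T * W)
      = (3 / (2 * A) + 1 / (2 * a2)) * (1 / T * (1 / W))"
    using pos D by (simp add: field_simps)
  also have "1 / T = indicator {-R..R} t / T"
  proof -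
    have "\<bar>t\<bar> < 1 / a2" using True D by (simp add: field_simps)
    then show ?thesis using R by (auto simp: indicator_def)
  qed
  also have "1 / W = indicator {-1<..<1} w / W" using True by (auto simp: indicator_def)
  finally show ?thesis by (simp add: W_def T_def A_def)
qed

section \<open>From integrals over the regions to integrals of rescaled functions\<close>

lemma F_ell_measurable [measurable]: "F_ell a b \<in> borel_measurable borel"
  unfolding F_ell_def by (rule borel_measurable_plane) measurable

lemma E_ell_measurable [measurable]: "E_ell a b \<in> sets borel"
  unfolding E_ell_def by measurable

lemma K_fun_measurable [measurable]: "K_fun s a1 b1 a2 b2 \<in> borel_measurable borel"
proof -
  have [measurable]: "F0 a1 b1 a2 b2 \<in> borel_measurable borel"
    unfolding F0_def by (rule borel_measurable_plane) measurable
  show ?thesis unfolding K_fun_def[abs_def] by measurable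
qed

text \<open>Inverting the parameter carries \<open>at_right 0\<close> to
  \<open>at_top\<close>.\<close>

lemma integral_dominated_convergence_at_right_0:
  fixes s :: "real \<Rightarrow> 'a \<Rightarrow> 'b::{banach, second_countable_topology}" and w :: "'a \<Rightarrow> real"
  assumes "f \<in> borel_measurable M" "\<And>i. s i \<in> borel_measurable M" "integrable M w"
    and lim: "AE x in M. ((\<lambda>i. s i x) \<longlongrightarrow> f x) (at_right 0)"
    and bound: "\<forall>\<^sub>F i in at_right 0. AE x in M. norm (s i x) \<le> w x"
  shows "((\<lambda>i. integral\<^sup>L M (s i)) \<longlongrightarrow> integral\<^sup>L M f) (at_right 0)"
  unfolding filterlim_at_right_to_top
proof (rule integral_dominated_convergence_at_top)
  show "AE x in M. ((\<lambda>i. s (inverse i) x) \<longlongrightarrow> f x) at_top"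
    using lim by (simp add: filterlim_at_right_to_top)
  show "\<forall>\<^sub>F i in at_top. AE x in M. norm (s (inverse i) x) \<le> w x"
    using bound by (simp add: eventually_at_right_to_top)
qed (use assms in auto)

text \<open>The Jacobian is included. The set \<open>S\<close> of values of t selects the region:
  |t| > 1 for \<open>D1\<close> and |t| <= 1 for \<open>D2\<close>.\<close>

definition scaled_integrand ::
    "real \<Rightarrow> real \<Rightarrow> real \<Rightarrow> real \<Rightarrow> real \<Rightarrow> (real \<times> real \<Rightarrow> real) \<Rightarrow> real set \<Rightarrow> real \<times> real \<Rightarrow> real" where
  "scaled_integrand a1 b1 a2 b2 s h S = (\<lambda>(t, w).
     let m = fiber_radius a1 b1 a2 b2 t; z = (a1 * a2 * t, m * w)
     in indicator S t * (a1 * a2 * m * K_fun s a1 b1 a2 b2 z * h z))"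

lemma scaled_integrand_measurable [measurable]:
  assumes [measurable]: "h \<in> borel_measurable borel" "S \<in> sets borel"
  shows "scaled_integrand a1 b1 a2 b2 s h S \<in> borel_measurable borel"
proof -
  have [measurable]: "K_fun s a1 b1 a2 b2 \<in> borel_measurable (borel \<Otimes>\<^sub>M borel)"
    "h \<in> borel_measurable (borel \<Otimes>\<^sub>M borel)"
    by (simp_all add: borel_prod)
  show ?thesis
    unfolding scaled_integrand_def Let_def by (rule borel_measurable_plane) measurable
qed

definition kernel_majorant :: "real \<Rightarrow> real \<times> real \<Rightarrow> real" where
  "kernel_majorant R = (\<lambda>(t, w).
     indicator {-R..R} t / sqrt \<bar>1 - t\<^sup>2\<bar> * (indicator {-1<..<1} w / sqrt (1 - w\<^sup>2)))"

lemma kernel_majorant_nonneg: "0 \<le> kernel_majorant R z"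
  by (auto simp: kernel_majorant_def indicator_def abs_square_le_1 split: prod.split)

lemma integrable_kernel_majorant: "integrable lborel (\<lambda>z. c * kernel_majorant R z)"
proof -
  have "integrable lborel (\<lambda>w::real. indicator {-1<..<1} w / sqrt (1 - w\<^sup>2))"
    using has_bochner_integral_arcsin_deriv by (simp add: has_bochner_integral_iff)
  from integrable_lborel_prod_mult[OF integrable_inverse_sqrt_abs_one_minus_square this]
  show ?thesis unfolding kernel_majorant_def by (rule integrable_mult_right)
qed

text \<open>\<open>R\<close> and \<open>C\<close> are left free so that one estimate serves twice:
  with the exact constants for integrability at a given \<open>b2\<close>, and with constants
  independent of \<open>b2\<close> for the limit.\<close>

lemma abs_scaled_integrand_le:
  assumes adm: "admissible a1 b1 a2 b2" and s: "\<bar>s\<bar> \<le> 1" and h: "\<And>z. \<bar>h z\<bar> \<le> H"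
    and R: "1 / a2 \<le> R" and C: "3 / (2 * sqrt (a2\<^sup>2 - a1\<^sup>2)) + 1 / (2 * a2) \<le> C"
  shows "AE z in lborel. norm (scaled_integrand a1 b1 a2 b2 s h S z) \<le> H * C * kernel_majorant R z"
  using AE_lborel_fst_neq[of 1] AE_lborel_fst_neq[of "-1"]
proof eventually_elim
  case (elim z)
  obtain t w where z: "z = (t, w)" by (cases z)
  have t: "\<bar>t\<bar> \<noteq> 1" using elim by (auto simp: z abs_if split: if_splits)
  let ?m = "fiber_radius a1 b1 a2 b2 t"
  let ?g = "kernel_majorant R (t, w)"
  let ?y = "(a1 * a2 * t, ?m * w)"
  have g: "0 \<le> ?g" by (rule kernel_majorant_nonneg)
  have "\<bar>a1 * a2 * ?m * K_fun s a1 b1 a2 b2 ?y\<bar> \<le> C * ?g"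
    using abs_K_fun_scaled_le[OF adm t s R, of w] mult_right_mono[OF C g]
    by (simp add: kernel_majorant_def)
  then have "\<bar>a1 * a2 * ?m * K_fun s a1 b1 a2 b2 ?y\<bar> * \<bar>h ?y\<bar> \<le> C * ?g * H"
    using h[of ?y] by (intro mult_mono) auto
  moreover have "norm (scaled_integrand a1 b1 a2 b2 s h S z) \<le> \<bar>a1 * a2 * ?m * K_fun s a1 b1 a2 b2 ?y\<bar> * \<bar>h ?y\<bar>"
    by (auto simp: scaled_integrand_def Let_def z abs_mult indicator_def)
  ultimately show ?case by (simp add: z mult_ac)
qed

text \<open>Treats both regions at once: the hypothesis on \<open>D\<close> replaces it by the strip
  over \<open>V\<close>, whose pullback under the substitution is the strip over
  \<open>S\<close>.\<close>

lemma region_integral: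
  assumes adm: "admissible a1 b1 a2 b2" and s: "\<bar>s\<bar> \<le> 1"
    and [measurable]: "h \<in> borel_measurable borel" and h: "\<And>z. \<bar>h z\<bar> \<le> H"
    and [measurable]: "S \<in> sets borel" "V \<in> sets borel"
    and D: "\<And>v u. indicator D (v, u) * K_fun s a1 b1 a2 b2 (v, u) = indicator V v * K_fun s a1 b1 a2 b2 (v, u)"
    and V: "\<And>t. a1 * a2 * t \<in> V \<longleftrightarrow> t \<in> S"
  shows "set_integrable lborel D (\<lambda>z. h z * K_fun s a1 b1 a2 b2 z)"
    and "(LINT z:D|lborel. h z * K_fun s a1 b1 a2 b2 z) = integral\<^sup>L lborel (scaled_integrand a1 b1 a2 b2 s h S)"
proof -
  define f where "f = (\<lambda>z. indicator V (fst z) * (h z * K_fun s a1 b1 a2 b2 z))"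
  have f_eq: "(\<lambda>z. indicator D z *\<^sub>R (h z * K_fun s a1 b1 a2 b2 z)) = f"
    using D by (auto simp: fun_eq_iff f_def mult.left_commute)
  have [measurable]: "(\<lambda>z :: real \<times> real. indicator V (fst z) :: real) \<in> borel_measurable borel"
    by (rule borel_measurable_plane) measurable
  have f: "f \<in> borel_measurable borel" unfolding f_def by measurable
  have J: "(\<lambda>(t, w). a1 * a2 * fiber_radius a1 b1 a2 b2 t * f (a1 * a2 * t, fiber_radius a1 b1 a2 b2 t * w))
      = scaled_integrand a1 b1 a2 b2 s h S"
    by (auto simp: fun_eq_iff f_def scaled_integrand_def Let_def V indicator_def)
  have a: "0 < a1 * a2" using admissibleD[OF adm] by simp
  note scaling = lborel_fiberwise_scaling[OF a fiber_radius_pos[OF adm] borel_measurable_fiber_radius f, unfolded J]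
  have "integrable lborel (scaled_integrand a1 b1 a2 b2 s h S)"
    by (rule Bochner_Integration.integrable_bound[OF integrable_kernel_majorant[of
          "H * (3 / (2 * sqrt (a2\<^sup>2 - a1\<^sup>2)) + 1 / (2 * a2))" "1 / a2"]])
       (use abs_scaled_integrand_le[where h = h and S = S, OF adm s h order_refl order_refl] in
         \<open>auto elim!: eventually_mono intro: order_trans[OF _ abs_ge_self]\<close>)
  then show "set_integrable lborel D (\<lambda>z. h z * K_fun s a1 b1 a2 b2 z)"
    unfolding set_integrable_def f_eq by (simp add: scaling)
  show "(LINT z:D|lborel. h z * K_fun s a1 b1 a2 b2 z) = integral\<^sup>L lborel (scaled_integrand a1 b1 a2 b2 s h S)"
    unfolding set_lebesgue_integral_def f_eq by (rule scaling)
qed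

lemma
  assumes adm: "admissible a1 b1 a2 b2" and s: "\<bar>s\<bar> \<le> 1"
    and h: "h \<in> borel_measurable borel" "\<And>z. \<bar>h z\<bar> \<le> H"
  shows set_integrable_D1: "set_integrable lborel (D1 a1 b1 a2 b2) (\<lambda>z. h z * K_fun s a1 b1 a2 b2 z)"
    and integral_D1: "(LINT z:D1 a1 b1 a2 b2|lborel. h z * K_fun s a1 b1 a2 b2 z) =
      integral\<^sup>L lborel (scaled_integrand a1 b1 a2 b2 s h {t. 1 < \<bar>t\<bar>})"
    and set_integrable_D2: "set_integrable lborel (D2 a1 b1 a2 b2) (\<lambda>z. h z * K_fun s a1 b1 a2 b2 z)"
    and integral_D2: "(LINT z:D2 a1 b1 a2 b2|lborel. h z * K_fun s a1 b1 a2 b2 z) =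
      integral\<^sup>L lborel (scaled_integrand a1 b1 a2 b2 s h {t. \<bar>t\<bar> \<le> 1})"
proof -
  have a: "0 < a1 * a2" using admissibleD[OF adm] by simp
  then have V: "a1 * a2 < \<bar>a1 * a2 * t\<bar> \<longleftrightarrow> 1 < \<bar>t\<bar>" for t
    using mult_less_cancel_left_pos[OF a, of 1 "\<bar>t\<bar>"] by (simp add: abs_mult[of "a1 * a2"] del: mult_less_cancel_left_pos)
  then have V': "\<bar>a1 * a2 * t\<bar> \<le> a1 * a2 \<longleftrightarrow> \<bar>t\<bar> \<le> 1" for t by (meson not_le)
  note R = region_integral[OF adm s h]
  note R1 = R[OF _ _ K_fun_on_D1[OF adm], of "{t. 1 < \<bar>t\<bar>}"] and R2 = R[OF _ _ K_fun_on_D2[OF adm], of "{t. \<bar>t\<bar> \<le> 1}"]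
  show "set_integrable lborel (D1 a1 b1 a2 b2) (\<lambda>z. h z * K_fun s a1 b1 a2 b2 z)"
    by (rule R1(1)) (auto simp: V)
  show "(LINT z:D1 a1 b1 a2 b2|lborel. h z * K_fun s a1 b1 a2 b2 z) =
      integral\<^sup>L lborel (scaled_integrand a1 b1 a2 b2 s h {t. 1 < \<bar>t\<bar>})"
    by (rule R1(2)) (auto simp: V)
  show "set_integrable lborel (D2 a1 b1 a2 b2) (\<lambda>z. h z * K_fun s a1 b1 a2 b2 z)"
    by (rule R2(1)) (auto simp: V')
  show "(LINT z:D2 a1 b1 a2 b2|lborel. h z * K_fun s a1 b1 a2 b2 z) =
      integral\<^sup>L lborel (scaled_integrand a1 b1 a2 b2 s h {t. \<bar>t\<bar> \<le> 1})"
    by (rule R2(2)) (auto simp: V')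
qed

section \<open>Pointwise limits and a uniform bound as \<open>b2\<close> tends to 0\<close>

lemma eventually_admissible:
  assumes a1: "0 < a1" "a1 < 1"
  shows "\<forall>\<^sub>F b2 in at_right 0. admissible a1 (sqrt (1 - a1\<^sup>2)) (sqrt (1 - b2\<^sup>2)) b2"
proof -
  have "a1\<^sup>2 < 1" using a1 by (simp add: power_less_one_iff)
  then have "\<forall>\<^sub>F b2 in at_right 0. b2 \<in> {0<..<sqrt (1 - a1\<^sup>2)}"
    by (intro eventually_at_right_real) simp
  then show ?thesis
    by eventually_elim (use a1 in \<open>auto intro!: admissible_small_b2\<close>)
qed

text \<open>Since \<open>a2\<close> tends to 1, eventually \<open>a2\<close> |t| > 1: the point has
  left the first ellipse and the integrand is exactly 0.\<close>

lemma scaled_integrand_tendsto_0: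
  assumes a1: "0 < a1" "a1 < 1" and t: "1 < \<bar>t\<bar>"
  shows "((\<lambda>b2. scaled_integrand a1 (sqrt (1 - a1\<^sup>2)) (sqrt (1 - b2\<^sup>2)) b2 s h S (t, w)) \<longlongrightarrow> 0) (at_right 0)"
proof (rule tendsto_eventually)
  have "((\<lambda>b2. sqrt (1 - b2\<^sup>2) * \<bar>t\<bar>) \<longlongrightarrow> sqrt (1 - 0\<^sup>2) * \<bar>t\<bar>) (at_right 0)"
    by (intro tendsto_intros)
  then have "\<forall>\<^sub>F b2 in at_right 0. 1 < sqrt (1 - b2\<^sup>2) * \<bar>t\<bar>"
    using t by (auto dest!: order_tendstoD(1)[where a = 1])
  then show "\<forall>\<^sub>F b2 in at_right 0. scaled_integrand a1 (sqrt (1 - a1\<^sup>2)) (sqrt (1 - b2\<^sup>2)) b2 s h S (t, w) = 0"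
    using eventually_admissible[OF a1]
    by eventually_elim (simp add: scaled_integrand_def Let_def K_fun_scaled_eq_0)
qed

text \<open>\<open>kernel_num\<close> tends to b1^2 (1 - (a1 t)^2) and \<open>kernel_den\<close> to
  b1^2 (1 - t^2), which leaves one factor b1. The summand with \<open>s\<close> carries m and dies,
  and u = m w tends to 0, which is why \<open>h\<close> is evaluated on the axis.\<close>

lemma scaled_integrand_tendsto:
  assumes a1: "0 < a1" "a1 < 1" and t: "\<bar>t\<bar> < 1" and h: "continuous_on UNIV h"
  defines "b1 \<equiv> sqrt (1 - a1\<^sup>2)"
  shows "((\<lambda>b2. scaled_integrand a1 b1 (sqrt (1 - b2\<^sup>2)) b2 s h {t. \<bar>t\<bar> \<le> 1} (t, w)) \<longlongrightarrow>
    b1 / 4 * ((1 - (a1 * t)\<^sup>2) / sqrt (1 - t\<^sup>2) * h (a1 * t, 0)) * (indicator {-1<..<1} w / sqrt (1 - w\<^sup>2))) (at_right 0)"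
proof (cases "\<bar>w\<bar> < 1")
  case False
  have "\<forall>\<^sub>F b2 in at_right 0. scaled_integrand a1 b1 (sqrt (1 - b2\<^sup>2)) b2 s h {t. \<bar>t\<bar> \<le> 1} (t, w) = 0"
    using eventually_admissible[OF a1] unfolding b1_def
    by eventually_elim (use False in \<open>simp add: scaled_integrand_def Let_def K_fun_scaled_eq_0\<close>)
  then show ?thesis using False by (auto simp: indicator_def intro!: tendsto_eventually)
next
  case True
  have a1sq: "a1\<^sup>2 < 1" and t2: "t\<^sup>2 < 1" and w2: "w\<^sup>2 < 1"
    using a1 t True by (auto simp: power_less_one_iff abs_square_less_1)
  then have b1: "0 < b1" "b1\<^sup>2 = 1 - a1\<^sup>2" by (auto simp: b1_def)
  define a2 where "a2 = (\<lambda>b2::real. sqrt (1 - b2\<^sup>2))"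
  define m where "m = (\<lambda>b2. fiber_radius a1 b1 (a2 b2) b2 t)"
  have adm: "\<forall>\<^sub>F b2 in at_right 0. admissible a1 b1 (a2 b2) b2"
    using eventually_admissible[OF a1] by (simp add: b1_def a2_def)
  have at: "a2 b2 * \<bar>t\<bar> < 1" if "admissible a1 b1 (a2 b2) b2" for b2
  proof -
    have "a2 b2 * \<bar>t\<bar> \<le> 1 * \<bar>t\<bar>" using admissibleD[OF that] by (intro mult_right_mono) auto
    then show ?thesis using t by simp
  qed
  have "(a2 \<longlongrightarrow> sqrt (1 - 0\<^sup>2)) (at_right 0)"
    unfolding a2_def by (intro tendsto_intros)
  then have a2: "(a2 \<longlongrightarrow> 1) (at_right 0)" by simp
  have id: "((\<lambda>b2. b2) \<longlongrightarrow> (0::real)) (at_right 0)" by (rule tendsto_ident_at)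
  \<comment> \<open>The minimum in \<open>fiber_radius\<close> is at most its second entry, hence at
    most \<open>b2\<close>.\<close>
  have m: "(m \<longlongrightarrow> 0) (at_right 0)"
  proof (rule tendsto_sandwich[OF _ _ tendsto_const id])
    show "\<forall>\<^sub>F b2 in at_right 0. 0 \<le> m b2"
      using adm by eventually_elim (simp add: m_def fiber_radius_pos less_imp_le)
    show "\<forall>\<^sub>F b2 in at_right 0. m b2 \<le> b2"
      using adm
    proof eventually_elim
      case (elim b2)
      have "b2 * sqrt (1 - (a1 * t)\<^sup>2) \<le> b2 * 1"
        using admissibleD(7)[OF elim] by (intro mult_left_mono) auto
      then show ?case using at[OF elim] by (simp add: m_def fiber_radius_def)
    qed
  qed
  have "isCont h (a1 * 1 * t, 0 * w)" using h by (simp add: continuous_on_eq_continuous_at)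
  then have hlim: "((\<lambda>b2. h (a1 * a2 b2 * t, m b2 * w)) \<longlongrightarrow> h (a1 * 1 * t, 0 * w)) (at_right 0)"
    by (rule isCont_tendsto_compose) (intro tendsto_intros a2 m)
  have den: "((\<lambda>b2. kernel_den a1 b1 (a2 b2) b2 t w) \<longlongrightarrow> (1\<^sup>2 - a1\<^sup>2) * \<bar>1 - t\<^sup>2\<bar> + 0\<^sup>2 * (1 - w\<^sup>2)) (at_right 0)"
    unfolding kernel_den_def m_def[symmetric] by (intro tendsto_intros a2 m[unfolded m_def])
  have num: "((\<lambda>b2. kernel_num a1 b1 (a2 b2) b2 t w) \<longlongrightarrow>
     (a1 * 0)\<^sup>2 + (1 * b1)\<^sup>2 - (a1 * 1 * t)\<^sup>2 * (b1\<^sup>2 + 0\<^sup>2) - (0 * w)\<^sup>2 * (a1\<^sup>2 + 1\<^sup>2)) (at_right 0)"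
    unfolding kernel_num_def m_def[symmetric] by (intro tendsto_intros a2 id m[unfolded m_def])
  have nz: "4 * sqrt (1 - w\<^sup>2) * sqrt ((1\<^sup>2 - a1\<^sup>2) * \<bar>1 - t\<^sup>2\<bar> + 0\<^sup>2 * (1 - w\<^sup>2)) \<noteq> 0"
    using w2 t2 a1sq by simp
  have "((\<lambda>b2. (kernel_num a1 b1 (a2 b2) b2 t w / (4 * sqrt (1 - w\<^sup>2) * sqrt (kernel_den a1 b1 (a2 b2) b2 t w))
      + s * a1 * a2 b2 * m b2 / 2) * h (a1 * a2 b2 * t, m b2 * w)) \<longlongrightarrow>
      (((a1 * 0)\<^sup>2 + (1 * b1)\<^sup>2 - (a1 * 1 * t)\<^sup>2 * (b1\<^sup>2 + 0\<^sup>2) - (0 * w)\<^sup>2 * (a1\<^sup>2 + 1\<^sup>2))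
        / (4 * sqrt (1 - w\<^sup>2) * sqrt ((1\<^sup>2 - a1\<^sup>2) * \<bar>1 - t\<^sup>2\<bar> + 0\<^sup>2 * (1 - w\<^sup>2)))
      + s * a1 * 1 * 0 / 2) * h (a1 * 1 * t, 0 * w)) (at_right 0)"
    by (intro tendsto_intros num den a2 m hlim nz) simp
  also have "((a1 * 0)\<^sup>2 + (1 * b1)\<^sup>2 - (a1 * 1 * t)\<^sup>2 * (b1\<^sup>2 + 0\<^sup>2) - (0 * w)\<^sup>2 * (a1\<^sup>2 + 1\<^sup>2)) = b1\<^sup>2 * (1 - (a1 * t)\<^sup>2)"
    by (simp add: algebra_simps)
  also have "sqrt ((1\<^sup>2 - a1\<^sup>2) * \<bar>1 - t\<^sup>2\<bar> + 0\<^sup>2 * (1 - w\<^sup>2)) = b1 * sqrt (1 - t\<^sup>2)"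
    using t2 by (simp add: real_sqrt_mult b1_def)
  also have "(b1\<^sup>2 * (1 - (a1 * t)\<^sup>2) / (4 * sqrt (1 - w\<^sup>2) * (b1 * sqrt (1 - t\<^sup>2))) + s * a1 * 1 * 0 / 2) * h (a1 * 1 * t, 0 * w)
     = b1 / 4 * ((1 - (a1 * t)\<^sup>2) / sqrt (1 - t\<^sup>2) * h (a1 * t, 0)) * (indicator {-1<..<1} w / sqrt (1 - w\<^sup>2))"
    using b1(1) True by (simp add: power2_eq_square abs_less_iff mult_ac)
  finally have *: "((\<lambda>b2. (kernel_num a1 b1 (a2 b2) b2 t w / (4 * sqrt (1 - w\<^sup>2) * sqrt (kernel_den a1 b1 (a2 b2) b2 t w))
      + s * a1 * a2 b2 * m b2 / 2) * h (a1 * a2 b2 * t, m b2 * w)) \<longlongrightarrow>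
      b1 / 4 * ((1 - (a1 * t)\<^sup>2) / sqrt (1 - t\<^sup>2) * h (a1 * t, 0)) * (indicator {-1<..<1} w / sqrt (1 - w\<^sup>2))) (at_right 0)" .
  have "\<forall>\<^sub>F b2 in at_right 0. (kernel_num a1 b1 (a2 b2) b2 t w / (4 * sqrt (1 - w\<^sup>2) * sqrt (kernel_den a1 b1 (a2 b2) b2 t w))
      + s * a1 * a2 b2 * m b2 / 2) * h (a1 * a2 b2 * t, m b2 * w)
      = scaled_integrand a1 b1 (a2 b2) b2 s h {t. \<bar>t\<bar> \<le> 1} (t, w)"
    using adm
  proof eventually_elim
    case (elim b2)
    then show ?case
      using K_fun_scaled[OF elim at[OF elim] True, of s] t
      by (simp add: scaled_integrand_def Let_def m_def)
  qed
  then show ?thesis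
    using Lim_transform_eventually[OF *] by (simp add: a2_def)
qed

text \<open>Once b2^2 < (1 - a1^2) / 2, the difference a2^2 - a1^2 is at least (1 - a1^2) / 2 and
  \<open>a2\<close> is at least 1 / 2. This gives the constant and the cutoff 2 for |t|.\<close>

lemma eventually_abs_scaled_integrand_le:
  assumes a1: "0 < a1" "a1 < 1" and s: "\<bar>s\<bar> \<le> 1" and h: "\<And>z. \<bar>h z\<bar> \<le> H"
  shows "\<forall>\<^sub>F b2 in at_right 0. AE z in lborel.
    norm (scaled_integrand a1 (sqrt (1 - a1\<^sup>2)) (sqrt (1 - b2\<^sup>2)) b2 s h S z) \<le>
      H * (3 / (2 * sqrt ((1 - a1\<^sup>2) / 2)) + 1) * kernel_majorant 2 z"
proof -
  have a1sq: "0 < 1 - a1\<^sup>2" using a1 by (simp add: power_less_one_iff)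
  have "((\<lambda>b2::real. b2\<^sup>2) \<longlongrightarrow> 0\<^sup>2) (at_right 0)" by (intro tendsto_intros)
  then have "\<forall>\<^sub>F b2::real in at_right 0. b2\<^sup>2 < (1 - a1\<^sup>2) / 2"
    by (rule order_tendstoD(2)) (use a1sq in simp)
  then show ?thesis
    using eventually_admissible[OF a1]
  proof eventually_elim
    case (elim b2)
    note D = admissibleD[OF elim(2)]
    define a2 where "a2 = sqrt (1 - b2\<^sup>2)"
    have a2sq: "a2\<^sup>2 = 1 - b2\<^sup>2" using D by (simp add: a2_def)
    have "2 * b2\<^sup>2 < 1 - a1\<^sup>2" using elim(1) by simp
    then have "b2\<^sup>2 < 1 / 2" using zero_le_power2[of a1] by linarith
    then have "1 / 4 \<le> a2\<^sup>2" unfolding a2sq by simp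
    then have "(1 / 2)\<^sup>2 \<le> a2\<^sup>2" by (simp add: power2_eq_square)
    then have a2: "1 / 2 \<le> a2" using D(3) power2_le_imp_le[of "1/2" a2] by (simp add: a2_def)
    have "(1 - a1\<^sup>2) / 2 \<le> a2\<^sup>2 - a1\<^sup>2" using elim(1) unfolding a2sq by simp
    then have "sqrt ((1 - a1\<^sup>2) / 2) \<le> sqrt (a2\<^sup>2 - a1\<^sup>2)" by (rule real_sqrt_le_mono)
    then have "3 / (2 * sqrt (a2\<^sup>2 - a1\<^sup>2)) \<le> 3 / (2 * sqrt ((1 - a1\<^sup>2) / 2))"
      using a1sq by (intro frac_le) auto
    moreover have "1 / (2 * a2) \<le> 1" "1 / a2 \<le> 2" using a2 by (auto simp: field_simps)
    ultimately show ?case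
      using abs_scaled_integrand_le[where R = 2 and C = "3 / (2 * sqrt ((1 - a1\<^sup>2) / 2)) + 1" and h = h and S = S, OF elim(2) s h]
      by (simp add: a2_def)
  qed
qed

section \<open>The limit density and the main result\<close>

text \<open>Under v = a1 t the factor a1 of dv cancels against sqrt (a1^2 - v^2) = a1 sqrt (1 -
  t^2). Integrability follows from |1 - (a1 t)^2| <= 1 and the bound on \<open>h\<close>.\<close>

lemma rescaled_limit_density:
  fixes h :: "real \<times> real \<Rightarrow> real"
  assumes a1: "0 < a1" "a1 < 1" and hm: "h \<in> borel_measurable borel" and h: "\<And>z. \<bar>h z\<bar> \<le> H"
  defines "f \<equiv> \<lambda>t. indicator {-1<..<1} t * ((1 - (a1 * t)\<^sup>2) / sqrt (1 - t\<^sup>2) * h (a1 * t, 0))"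
  shows "integrable lborel f"
    and "set_integrable lborel {- a1..a1} (\<lambda>v. (1 - v\<^sup>2) / sqrt (a1\<^sup>2 - v\<^sup>2) * h (v, 0))"
    and "(LINT v:{- a1..a1}|lborel. (1 - v\<^sup>2) / sqrt (a1\<^sup>2 - v\<^sup>2) * h (v, 0)) = integral\<^sup>L lborel f"
proof -
  have [measurable]: "h \<in> borel_measurable (borel \<Otimes>\<^sub>M borel)" using hm by (simp add: borel_prod)
  let ?g = "\<lambda>v. indicator {- a1..a1} v *\<^sub>R ((1 - v\<^sup>2) / sqrt (a1\<^sup>2 - v\<^sup>2) * h (v, 0))"
  have "integrable lborel (\<lambda>t::real. H * (indicator {-1<..<1} t / sqrt (1 - t\<^sup>2)))"
    using has_bochner_integral_arcsin_deriv by (intro integrable_mult_right) (auto simp: has_bochner_integral_iff)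
  then show f: "integrable lborel f"
  proof (rule Bochner_Integration.integrable_bound)
    show "f \<in> borel_measurable lborel" unfolding f_def by measurable
    have "norm (f t) \<le> H * (indicator {-1<..<1} t / sqrt (1 - t\<^sup>2))" for t
    proof (cases "\<bar>t\<bar> < 1")
      case True
      then have t: "t\<^sup>2 < 1" "-1 < t" "t < 1" by (auto simp: abs_square_less_1)
      have "\<bar>a1 * t\<bar> \<le> 1 * 1" unfolding abs_mult using True a1 by (intro mult_mono) auto
      then have "(a1 * t)\<^sup>2 \<le> 1" by (simp add: abs_square_le_1)
      then have "\<bar>1 - (a1 * t)\<^sup>2\<bar> * \<bar>h (a1 * t, 0)\<bar> \<le> 1 * H" using h by (intro mult_mono) auto
      then have "\<bar>1 - (a1 * t)\<^sup>2\<bar> * \<bar>h (a1 * t, 0)\<bar> / sqrt (1 - t\<^sup>2) \<le> 1 * H / sqrt (1 - t\<^sup>2)"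
        using t by (intro divide_right_mono) auto
      then show ?thesis using t by (simp add: f_def abs_mult)
    qed (auto simp: f_def indicator_def)
    then show "AE t in lborel. norm (f t) \<le> norm (H * (indicator {-1<..<1} t / sqrt (1 - t\<^sup>2)))"
      by (intro AE_I2) (metis order_trans real_norm_def abs_ge_self)
  qed
  have g: "a1 * ?g (0 + a1 * t) = f t" for t
  proof -
    consider "\<bar>t\<bar> < 1" | "\<bar>t\<bar> = 1" | "1 < \<bar>t\<bar>" by linarith
    then show ?thesis
    proof cases
      case 1
      have "a1\<^sup>2 - (a1 * t)\<^sup>2 = a1\<^sup>2 * (1 - t\<^sup>2)" by (simp add: power_mult_distrib right_diff_distrib)
      then have "sqrt (a1\<^sup>2 - (a1 * t)\<^sup>2) = a1 * sqrt (1 - t\<^sup>2)" using a1 by (simp add: real_sqrt_mult)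
      moreover have "\<bar>a1 * t\<bar> \<le> a1" using 1 a1 by (simp add: abs_mult)
      ultimately show ?thesis using 1 a1 by (auto simp: f_def indicator_def abs_le_iff)
    next
      \<comment> \<open>At v = a1 and v = -a1 the quotient by \<open>sqrt 0\<close> is 0, so the
        closed interval of the integral and the open one in \<open>f\<close> agree at every
        point.\<close>
      case 2
      then have "t = 1 \<or> t = -1" by linarith
      then show ?thesis by (auto simp: f_def)
    next
      case 3
      then have "\<not> \<bar>a1 * t\<bar> \<le> a1" using a1 by (simp add: abs_mult)
      then show ?thesis using 3 by (auto simp: f_def indicator_def)
    qed
  qed
  have g': "?g (0 + a1 * t) = f t / a1" for t
    using g[of t] a1 by (simp add: nonzero_eq_divide_eq mult.commute)
  have "integrable lborel (\<lambda>t. ?g (0 + a1 * t))"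
    unfolding g' using f by simp
  then show "set_integrable lborel {- a1..a1} (\<lambda>v. (1 - v\<^sup>2) / sqrt (a1\<^sup>2 - v\<^sup>2) * h (v, 0))"
    unfolding set_integrable_def using a1 lborel_integrable_real_affine_iff[of a1 ?g 0] by simp
  show "(LINT v:{- a1..a1}|lborel. (1 - v\<^sup>2) / sqrt (a1\<^sup>2 - v\<^sup>2) * h (v, 0)) = integral\<^sup>L lborel f"
    unfolding set_lebesgue_integral_def
    using a1 by (subst lborel_integral_real_affine[of a1 _ 0]) (simp_all only: g', simp_all)
qed

theorem proposition11:
  fixes a1 b1 s :: real and h :: "real \<times> real \<Rightarrow> real"
  assumes "0 < a1" and "a1 < 1" and "b1 = sqrt (1 - a1\<^sup>2)"
    and "continuous_on UNIV h" and "bounded (range h)"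
    and "s = 1 \<or> s = - 1"
  shows
    "(\<forall>a2 b2. admissible a1 b1 a2 b2 \<longrightarrow>
        set_integrable lborel (D1 a1 b1 a2 b2) (\<lambda>z. h z * K_fun s a1 b1 a2 b2 z) \<and>
        set_integrable lborel (D2 a1 b1 a2 b2) (\<lambda>z. h z * K_fun s a1 b1 a2 b2 z)) \<and>
     set_integrable lborel {- a1..a1} (\<lambda>v. (1 - v\<^sup>2) / sqrt (a1\<^sup>2 - v\<^sup>2) * h (v, 0)) \<and>
     ((\<lambda>b2. LINT z:D1 a1 b1 (sqrt (1 - b2\<^sup>2)) b2|lborel.
               h z * K_fun s a1 b1 (sqrt (1 - b2\<^sup>2)) b2 z) \<longlongrightarrow> 0) (at_right 0) \<and>
     ((\<lambda>b2. LINT z:D2 a1 b1 (sqrt (1 - b2\<^sup>2)) b2|lborel.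
               h z * K_fun s a1 b1 (sqrt (1 - b2\<^sup>2)) b2 z) \<longlongrightarrow>
        pi * b1 / 4 *
          (LINT v:{- a1..a1}|lborel. (1 - v\<^sup>2) / sqrt (a1\<^sup>2 - v\<^sup>2) * h (v, 0))) (at_right 0)"
proof -
  note a1 = \<open>0 < a1\<close> \<open>a1 < 1\<close> and b1 = \<open>b1 = sqrt (1 - a1\<^sup>2)\<close> and cont = \<open>continuous_on UNIV h\<close>
  have s: "\<bar>s\<bar> \<le> 1" using assms by auto
  have hm [measurable]: "h \<in> borel_measurable borel"
    using cont by (rule borel_measurable_continuous_onI)
  obtain H where h: "\<bar>h z\<bar> \<le> H" for z
    using \<open>bounded (range h)\<close> by (auto simp: bounded_iff)
  define G where "G = (\<lambda>S b2. scaled_integrand a1 b1 (sqrt (1 - b2\<^sup>2)) b2 s h S)"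
  note adm = eventually_admissible[OF a1, folded b1]
  have bound: "\<forall>\<^sub>F b2 in at_right 0. AE z in lborel.
      norm (G S b2 z) \<le> H * (3 / (2 * sqrt ((1 - a1\<^sup>2) / 2)) + 1) * kernel_majorant 2 z" for S
    unfolding G_def b1 by (rule eventually_abs_scaled_integrand_le[where h = h, OF a1 s h])
  define f where "f = (\<lambda>t. indicator {-1<..<1} t * ((1 - (a1 * t)\<^sup>2) / sqrt (1 - t\<^sup>2) * h (a1 * t, 0)))"
  note f = rescaled_limit_density[where h = h, OF a1 hm h, folded f_def]
  define g where "g = (\<lambda>w::real. indicator {-1<..<1} w / sqrt (1 - w\<^sup>2))"
  have g: "integrable lborel g" "integral\<^sup>L lborel g = pi"
    using has_bochner_integral_arcsin_deriv by (auto simp: g_def has_bochner_integral_iff)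
  have bf: "integrable lborel (\<lambda>t. b1 / 4 * f t)" using f(1) by simp
  have [simp]: "{t :: real. 1 < \<bar>t\<bar>} \<in> sets borel" "{t :: real. \<bar>t\<bar> \<le> 1} \<in> sets borel"
    by measurable
  have G_meas: "G S b2 \<in> borel_measurable borel" if "S \<in> sets borel" for S b2
    using that unfolding G_def by measurable
  have "((\<lambda>b2. integral\<^sup>L lborel (G {t. 1 < \<bar>t\<bar>} b2)) \<longlongrightarrow> integral\<^sup>L lborel (\<lambda>z::real \<times> real. 0 :: real)) (at_right 0)"
  proof (rule integral_dominated_convergence_at_right_0[OF _ _ integrable_kernel_majorant _ bound])
    show "AE z in lborel. ((\<lambda>b2. G {t. 1 < \<bar>t\<bar>} b2 z) \<longlongrightarrow> 0) (at_right 0)"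
    proof (rule AE_I2)
      fix z :: "real \<times> real"
      obtain t w where "z = (t, w)" by (cases z)
      moreover have "((\<lambda>b2. G {t. 1 < \<bar>t\<bar>} b2 (t, w)) \<longlongrightarrow> 0) (at_right 0)"
      proof (cases "1 < \<bar>t\<bar>")
        case True
        then show ?thesis using scaled_integrand_tendsto_0[OF a1, of t] by (simp add: G_def b1)
      qed (simp add: G_def scaled_integrand_def Let_def)
      ultimately show "((\<lambda>b2. G {t. 1 < \<bar>t\<bar>} b2 z) \<longlongrightarrow> 0) (at_right 0)" by simp
    qed
  qed (auto simp: G_meas)
  then have lim1: "((\<lambda>b2. integral\<^sup>L lborel (G {t. 1 < \<bar>t\<bar>} b2)) \<longlongrightarrow> 0) (at_right 0)" by simp
  have "((\<lambda>b2. integral\<^sup>L lborel (G {t. \<bar>t\<bar> \<le> 1} b2)) \<longlongrightarrow> integral\<^sup>L lborel (\<lambda>(t, w). b1 / 4 * f t * g w)) (at_right 0)"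
  proof (rule integral_dominated_convergence_at_right_0[OF _ _ integrable_kernel_majorant _ bound])
    show "AE z in lborel. ((\<lambda>b2. G {t. \<bar>t\<bar> \<le> 1} b2 z) \<longlongrightarrow> (case z of (t, w) \<Rightarrow> b1 / 4 * f t * g w)) (at_right 0)"
      \<comment> \<open>For |t| = 1 \<open>kernel_den\<close> reduces to m^2 (1 - w^2), which tends
        to 0, so these two lines must be excluded from the pointwise limit.\<close>
      using AE_lborel_fst_neq[of 1] AE_lborel_fst_neq[of "-1"]
    proof eventually_elim
      case (elim z)
      obtain t w where z: "z = (t, w)" by (cases z)
      consider "\<bar>t\<bar> < 1" | "1 < \<bar>t\<bar>" using elim by (fastforce simp: z)
      then have "((\<lambda>b2. G {t. \<bar>t\<bar> \<le> 1} b2 (t, w)) \<longlongrightarrow> b1 / 4 * f t * g w) (at_right 0)"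
      proof cases
        case 1
        then show ?thesis using scaled_integrand_tendsto[OF a1 1 cont, of s w]
          by (simp add: G_def b1 f_def g_def abs_less_iff)
      next
        case 2
        then show ?thesis by (auto simp: G_def scaled_integrand_def Let_def f_def indicator_def)
      qed
      then show ?case by (simp add: z)
    qed
    show "(\<lambda>(t, w). b1 / 4 * f t * g w) \<in> borel_measurable lborel"
      using integrable_lborel_prod_mult[OF bf g(1)] by (rule borel_measurable_integrable)
  qed (auto simp: G_meas)
  also have "integral\<^sup>L lborel (\<lambda>(t, w). b1 / 4 * f t * g w) = pi * b1 / 4 * integral\<^sup>L lborel f"
    using integral_lborel_prod_mult[OF bf g(1)] g(2) by (simp add: mult_ac)
  also note f(3)[symmetric]
  finally have lim2: "((\<lambda>b2. integral\<^sup>L lborel (G {t. \<bar>t\<bar> \<le> 1} b2)) \<longlongrightarrow>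
      pi * b1 / 4 * (LINT v:{- a1..a1}|lborel. (1 - v\<^sup>2) / sqrt (a1\<^sup>2 - v\<^sup>2) * h (v, 0))) (at_right 0)" .
  \<comment> \<open>The rescaling identities require admissible parameters, so the integrals agree
    only for small \<open>b2\<close>, which suffices for the limits.\<close>
  have "\<forall>\<^sub>F b2 in at_right 0. integral\<^sup>L lborel (G {t. 1 < \<bar>t\<bar>} b2) =
      (LINT z:D1 a1 b1 (sqrt (1 - b2\<^sup>2)) b2|lborel. h z * K_fun s a1 b1 (sqrt (1 - b2\<^sup>2)) b2 z)"
    using adm by eventually_elim (simp add: G_def integral_D1[OF _ s hm h])
  moreover have "\<forall>\<^sub>F b2 in at_right 0. integral\<^sup>L lborel (G {t. \<bar>t\<bar> \<le> 1} b2) =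
      (LINT z:D2 a1 b1 (sqrt (1 - b2\<^sup>2)) b2|lborel. h z * K_fun s a1 b1 (sqrt (1 - b2\<^sup>2)) b2 z)"
    using adm by eventually_elim (simp add: G_def integral_D2[OF _ s hm h])
  ultimately show ?thesis
    by (intro conjI allI impI f(2) set_integrable_D1[OF _ s hm h] set_integrable_D2[OF _ s hm h]
        Lim_transform_eventually[OF lim1] Lim_transform_eventually[OF lim2])
qed

end
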